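(* Let $x,y$ be two generic $2\times 2$ matrices. Let $A=A_1A_2$ be an invariant, where $A_1$ is a product of $2h>0$ factors each of degree $1$ (each equal to $\mathrm{tr}(x)$ or $\mathrm{tr}(y)$) and $A_2$ is a product of $k$ factors each of degree $2$ (each equal to $\det(x)$, $\det(y)$ or $\mathrm{tr}(xy)$). If either $k=2\ell$ is even, or $k=2\ell+1$ is odd and $h\ge 2$, then $A\,[x,y]^4\,\mathtt t$ is the value of a balanced swap polynomial in the two variables $x,y$ for $2\times 2$ matrices.
   Context: The base field is $F=\mathbb Q$ (characteristic 0). A 2-tensor polynomial in $x,y$ is an element of $F\langle x,y\rangle^{\otimes 2}$, $F\langle x,y\rangle$ the free associative algebra; evaluating $x,y$ in $M_2(F)$ gives values in $M_2(F)^{\otimes 2}$. $\mathtt t=(1,2)=\sum_{i,j=1}^2 e_{i,j}\otimes e_{j,i}\in M_2(F)^{\otimes 2}$ is the swap operator $u\otimes v\mapsto v\otimes u$. A 2-tensor polynomial is a swap polynomial for $2\times 2$ matrices if, evaluated on $2\times2$ matrices, it is not identically zero and all its values are scalar multiples of $(1,2)$. It is balanced if it has the form $\sum_i A_i\otimes B_i$ with all $A_i,B_i$ homogeneous of the same degree. The ring of polynomial invariants of two $2\times2$ matrices under simultaneous conjugation is the polynomial ring generated by $\mathrm{tr}(x),\det(x),\mathrm{tr}(y),\det(y),\mathrm{tr}(xy)$. Here $[x,y]=xy-yx$, and $[x,y]^2=-\det([x,y])$ is a scalar matrix, identified with the scalar. *)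

theory Defs
  imports "HOL-Analysis.Analysis" "HOL-Library.Poly_Mapping"
begin

section \<open>The free algebra in two letters and its tensor square\<close>

datatype letter = X | Y

text \<open>
  Words in the letters form the free monoid. It is written additively because the convolution
  product of \<^type>\<open>poly_mapping\<close> asks for exponents in \<^class>\<open>monoid_add\<close>; with this instance
  \<open>letter list \<Rightarrow>\<^sub>0 rat\<close> is the free associative algebra \<open>\<rat>\<langle>x,y\<rangle>\<close>.
\<close>

instantiation list :: (type) monoid_add
begin

definition zero_list :: "'a list" where "zero_list = []"

definition plus_list :: "'a list \<Rightarrow> 'a list \<Rightarrow> 'a list" where "plus_list = (@)"

instance
  by standard (simp_all add: zero_list_def plus_list_def)

end

type_synonym free_algebra = "letter list \<Rightarrow>\<^sub>0 rat"

text \<open>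
  The tensor square of a monoid algebra is the monoid algebra of the product monoid, the pair
  \<open>(u, v)\<close> standing for the basis element \<open>u \<otimes> v\<close>.
\<close>

type_synonym tensor_polynomial = "letter list \<times> letter list \<Rightarrow>\<^sub>0 rat"

definition tensor :: "free_algebra \<Rightarrow> free_algebra \<Rightarrow> tensor_polynomial"  (infixl \<open>\<otimes>\<^sub>F\<close> 75)
  where "A \<otimes>\<^sub>F B = (\<Sum>u\<in>Poly_Mapping.keys A. \<Sum>v\<in>Poly_Mapping.keys B.
     Poly_Mapping.single (u, v) (Poly_Mapping.lookup A u * Poly_Mapping.lookup B v))"

definition homogeneous :: "nat \<Rightarrow> free_algebra \<Rightarrow> bool"
  where "homogeneous d A \<longleftrightarrow> (\<forall>w\<in>Poly_Mapping.keys A. length w = d)"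

definition balanced :: "tensor_polynomial \<Rightarrow> bool"
  where "balanced P \<longleftrightarrow> (\<exists>(d::nat) (n::nat) (A :: nat \<Rightarrow> free_algebra) (B :: nat \<Rightarrow> free_algebra).
     (\<forall>i<n. homogeneous d (A i) \<and> homogeneous d (B i)) \<and> P = (\<Sum>i<n. A i \<otimes>\<^sub>F B i))"


section \<open>Evaluation on two-by-two matrices\<close>

text \<open>
  Matrices have entries in a commutative ring \<open>'a\<close>. The tensor square of the algebra of
  two-by-two matrices is identified, by the Kronecker product, with the matrices
  whose rows and columns are indexed by pairs.
\<close>

type_synonym 'a mat2 = "'a ^ 2 ^ 2"
type_synonym 'a mat2_tensor = "'a ^ (2 \<times> 2) ^ (2 \<times> 2)"

definition kronecker :: "'a::comm_ring_1 mat2 \<Rightarrow> 'a mat2 \<Rightarrow> 'a mat2_tensor"  (infixl \<open>\<otimes>\<^sub>M\<close> 75)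
  where "M \<otimes>\<^sub>M N = (\<chi> p q. M $ fst p $ fst q * N $ snd p $ snd q)"

definition scale :: "'a::comm_ring_1 \<Rightarrow> 'a mat2_tensor \<Rightarrow> 'a mat2_tensor"  (infixr \<open>*\<^sub>M\<close> 75)
  where "c *\<^sub>M T = map_matrix ((*) c) T"

definition matrix_unit :: "2 \<Rightarrow> 2 \<Rightarrow> 'a::comm_ring_1 mat2"
  where "matrix_unit i j = (\<chi> k l. if k = i \<and> l = j then 1 else 0)"

definition swap_operator :: "'a::comm_ring_1 mat2_tensor"
  where "swap_operator = (\<Sum>i\<in>UNIV. \<Sum>j\<in>UNIV. matrix_unit i j \<otimes>\<^sub>M matrix_unit j i)"

lemma swap_operator_swaps:
  fixes u v :: "'a::comm_ring_1 ^ 2"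
  shows "swap_operator *v (\<chi> p. u $ fst p * v $ snd p) = (\<chi> p. v $ fst p * u $ snd p)"
proof -
  have "swap_operator $ p $ q = (if q = (snd p, fst p) then 1 else (0::'a))" for p q :: "2 \<times> 2"
  proof -
    have "swap_operator $ p $ q = (\<Sum>i\<in>UNIV. \<Sum>j\<in>UNIV.
        if j = snd p then if i = fst p \<and> q = (snd p, fst p) then 1 else 0 else (0::'a))"
      unfolding swap_operator_def kronecker_def matrix_unit_def
      by (simp only: sum_component vec_lambda_beta, intro sum.cong refl) (auto simp: prod_eq_iff)
    also have "\<dots> = (\<Sum>i\<in>UNIV. if i = fst p then if q = (snd p, fst p) then 1 else 0 else (0::'a))"
      by (intro sum.cong refl) simp
    finally show ?thesis
      by simp
  qed
  then show ?thesis
    by (simp add: matrix_vector_mult_def vec_eq_iff if_distrib[of "\<lambda>a. a * _"] mult.commute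
        cong: if_cong)
qed

primrec eval_word :: "'a::comm_ring_1 mat2 \<Rightarrow> 'a mat2 \<Rightarrow> letter list \<Rightarrow> 'a mat2" where
  "eval_word x y [] = mat 1"
| "eval_word x y (l # w) = (case l of X \<Rightarrow> x | Y \<Rightarrow> y) ** eval_word x y w"

text \<open>\<open>\<phi>\<close> is the structure map making \<open>'a\<close> a commutative \<open>\<rat>\<close>-algebra.\<close>

definition eval_tensor ::
    "(rat \<Rightarrow> 'a::comm_ring_1) \<Rightarrow> tensor_polynomial \<Rightarrow> 'a mat2 \<Rightarrow> 'a mat2 \<Rightarrow> 'a mat2_tensor"
  where "eval_tensor \<phi> P x y = (\<Sum>(u, v)\<in>Poly_Mapping.keys P.
     \<phi> (Poly_Mapping.lookup P (u, v)) *\<^sub>M (eval_word x y u \<otimes>\<^sub>M eval_word x y v))"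

definition swap_polynomial :: "tensor_polynomial \<Rightarrow> bool"
  where "swap_polynomial P \<longleftrightarrow>
     (\<exists>x y :: rat mat2. eval_tensor id P x y \<noteq> 0) \<and>
     (\<forall>x y :: rat mat2. \<exists>c. eval_tensor id P x y = c *\<^sub>M swap_operator)"


section \<open>Generic matrices\<close>

text \<open>
  The variable \<open>(l, i, j)\<close> is the \<open>(i, j)\<close> entry of the generic matrix belonging to the letter \<open>l\<close>.
\<close>

type_synonym entry_polynomial = "((letter \<times> 2 \<times> 2) \<Rightarrow>\<^sub>0 nat) \<Rightarrow>\<^sub>0 rat"

definition const :: "rat \<Rightarrow> entry_polynomial"
  where "const c = Poly_Mapping.single 0 c"

definition generic :: "letter \<Rightarrow> entry_polynomial mat2"
  where "generic l = (\<chi> i j. Poly_Mapping.single (Poly_Mapping.single (l, i, j) 1) 1)"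

definition commutator :: "'a::comm_ring_1 mat2 \<Rightarrow> 'a mat2 \<Rightarrow> 'a mat2"
  where "commutator x y = x ** y - y ** x"

text \<open>The scalar with which the scalar matrix \<open>[x,y]\<^sup>2\<close> is identified.\<close>

definition commutator_square :: "'a::comm_ring_1 mat2 \<Rightarrow> 'a mat2 \<Rightarrow> 'a"
  where "commutator_square x y = - det (commutator x y)"

lemma commutator_square:
  "commutator x y ** commutator x y = mat (commutator_square x y)"
  unfolding vec_eq_iff forall_2 matrix_matrix_mult_def mat_def
  by (simp add: commutator_square_def commutator_def det_2 matrix_matrix_mult_def sum_2
      algebra_simps)

end

theory Submission
  imports Defs
begin

text \<open>
  Write \<open>C = [x,y]\<close>, a matrix of trace \<open>0\<close> with \<open>C\<^sup>2 = D\<close> scalar, and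
  \<open>B(z,w) = 2 tr(zw) - tr(z) tr(w)\<close> (\<open>polar_discriminant\<close>). The proof rests on two facts.

  Moving \<open>C\<close> past \<open>x\<close> or \<open>y\<close> replaces that matrix by its adjugate, \<open>C z = adj(z) C\<close>. Hence
  \<open>z C + C z = tr(z) C\<close>, \<open>z C z = det(z) C\<close>, \<open>x y C + C y x = tr(x y) C\<close> and
  \<open>[z,[w,C]] = B(z,w) C\<close>: for every product \<open>I\<close> of the given generators of the invariants, the matrix
  \<open>I C\<close> is the value of a homogeneous noncommutative polynomial of degree \<open>deg I + 2\<close>, although
  \<open>I\<close> alone need not be one (\<open>eval_invariant_commutator\<close>).

  The swap operator is the Casimir element of the trace form. In the frame
  \<open>1, C, 2x - tr(x), 2y - tr(y)\<close>, in which \<open>1\<close> and \<open>C\<close> are orthogonal to each other and to the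
  other two, it has the denominator \<open>D\<close>; multiplication by \<open>C \<otimes> C\<close> removes the denominator, and
  multiplication by \<open>C \<otimes> C\<close> once more gives (\<open>swap_operator_expansion\<close>)
  \<open>8 D\<^sup>2 t = 4 C\<^sup>2 \<otimes> C\<^sup>2 + (B(x,y)\<^sup>2 - B(x,x) B(y,y)) C \<otimes> C + B(y,y) [x,C] \<otimes> [x,C]
    - B(x,y) ([x,C] \<otimes> [y,C] + [y,C] \<otimes> [x,C]) + B(x,x) [y,C] \<otimes> [y,C]\<close>.

  Multiply this by \<open>A\<close>. Every summand has a commutator on each side, so each side can absorb
  invariants, and only the degrees have to be balanced. The first two summands
  already are: \<open>B(x,y)\<^sup>2 - B(x,x) B(y,y)\<close> splits into products of factors of equal degree. They need a
  factorization \<open>A = I J\<close> with \<open>deg I = deg J\<close>. In the others a single factor \<open>B\<close> of degree \<open>2\<close>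
  sits on one side, so they need a factorization \<open>A = I' J'\<close> with \<open>deg J' = deg I' + 2\<close>. As \<open>A\<close> has
  an even and positive number of linear factors, both factorizations exist: depending on the parity of
  the number of quadratic factors, these are shared out equally or with one extra on one side, and
  the linear ones make up the difference (\<open>balanced_splittings\<close>).

  The noncommutative polynomials are written down explicitly, and they are evaluated in an arbitrary
  commutative \<open>\<rat>\<close>-algebra. One computation therefore serves both for generic matrices and for all
  rational matrices, as the definition of a swap polynomial requires.
\<close>

section \<open>Evaluating noncommutative polynomials\<close>

locale rational_algebra =
  fixes \<phi> :: "rat \<Rightarrow> 'a::comm_ring_1"
  assumes map_zero: "\<phi> 0 = 0" and map_one: "\<phi> 1 = 1"
    and map_add: "\<phi> (a + b) = \<phi> a + \<phi> b" and map_mult: "\<phi> (a * b) = \<phi> a * \<phi> b"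

lemma rational_algebra_id: "rational_algebra (id :: rat \<Rightarrow> rat)"
  by standard simp_all

lemma rational_algebra_const: "rational_algebra const"
  by standard (simp_all add: const_def single_add mult_single flip: single_one)

lemma poly_mapping_additive_induct [case_names zero single add]:
  fixes f :: "'k \<Rightarrow>\<^sub>0 'c::monoid_add"
  assumes "P 0" and "\<And>k c. P (Poly_Mapping.single k c)"
    and "\<And>f g. P f \<Longrightarrow> P g \<Longrightarrow> P (f + g)"
  shows "P f"
proof (induction f rule: update_induct)
  case const
  show ?case by fact
next
  case (update f a b)
  have "Poly_Mapping.update a b f = f + Poly_Mapping.single a b"
    using update(1)
    by (intro poly_mapping_eqI) (auto simp: lookup_update lookup_add lookup_single when_def in_keys_iff)
  with update assms show ?case by simp
qed

abbreviation smult_mat :: "'a::comm_ring_1 \<Rightarrow> 'a mat2 \<Rightarrow> 'a mat2"  (infixr \<open>*\<^sub>2\<close> 75)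
  where "c *\<^sub>2 M \<equiv> map_matrix ((*) c) M"

context rational_algebra
begin

text \<open>
  Matrix entries of the values of a noncommutative polynomial and of a tensor polynomial are both
  instances of this scalar-valued functional, so additivity is proved only once.
\<close>

definition linear_extension :: "('k \<Rightarrow> 'a) \<Rightarrow> ('k \<Rightarrow>\<^sub>0 rat) \<Rightarrow> 'a"
  where "linear_extension e f =
    (\<Sum>k\<in>Poly_Mapping.keys f. \<phi> (Poly_Mapping.lookup f k) * e k)"

lemma linear_extension_zero: "linear_extension e 0 = 0"
  by (simp add: linear_extension_def)

lemma linear_extension_single: "linear_extension e (Poly_Mapping.single k c) = \<phi> c * e k"
  by (simp add: linear_extension_def map_zero)

lemma linear_extension_add: "linear_extension e (f + g) = linear_extension e f + linear_extension e g"
  unfolding linear_extension_def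
  by (rule setsum_keys_plus_distrib) (simp_all add: map_zero map_add distrib_right)

lemma linear_extension_sum: "linear_extension e (sum f S) = (\<Sum>s\<in>S. linear_extension e (f s))"
  by (induction S rule: infinite_finite_induct) (simp_all add: linear_extension_zero linear_extension_add)

definition eval_free :: "'a mat2 \<Rightarrow> 'a mat2 \<Rightarrow> free_algebra \<Rightarrow> 'a mat2"
  where "eval_free x y f = (\<chi> i j. linear_extension (\<lambda>w. eval_word x y w $ i $ j) f)"

lemma eval_free_add: "eval_free x y (f + g) = eval_free x y f + eval_free x y g"
  by (simp add: eval_free_def vec_eq_iff linear_extension_add)

lemma eval_free_zero: "eval_free x y 0 = 0"
  by (simp add: eval_free_def vec_eq_iff linear_extension_zero)

lemma eval_free_uminus: "eval_free x y (- f) = - eval_free x y f"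
  using eval_free_add[of x y f "- f"] by (simp add: eval_free_zero eq_neg_iff_add_eq_0 add.commute)

lemma eval_free_diff: "eval_free x y (f - g) = eval_free x y f - eval_free x y g"
  using eval_free_add[of x y f "- g"] by (simp add: eval_free_uminus)

lemma eval_free_single: "eval_free x y (Poly_Mapping.single w c) = \<phi> c *\<^sub>2 eval_word x y w"
  by (simp add: eval_free_def vec_eq_iff linear_extension_single)

lemma mat2_add_rdistrib: "(K + L) ** M = K ** M + L ** (M :: 'a mat2)"
  by (simp add: vec_eq_iff matrix_matrix_mult_def distrib_right sum.distrib)

lemma eval_word_plus: "eval_word x y (u + v) = eval_word x y u ** eval_word x y v"
  unfolding plus_list_def by (induction u) (simp_all add: matrix_mul_assoc)

lemma eval_free_mult: "eval_free x y (f * g) = eval_free x y f ** eval_free x y g"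
proof (induction f rule: poly_mapping_additive_induct)
  case (single u c)
  show ?case
  proof (induction g rule: poly_mapping_additive_induct)
    case (single v d)
    show ?case
      by (simp add: mult_single eval_free_single eval_word_plus map_mult vec_eq_iff
          matrix_matrix_mult_def sum_distrib_left ac_simps)
  qed (simp_all add: eval_free_zero distrib_left eval_free_add matrix_add_ldistrib)
qed (simp_all add: eval_free_zero distrib_right eval_free_add mat2_add_rdistrib)

lemma eval_tensor_component:
  "eval_tensor \<phi> P x y $ p $ q = linear_extension
     (\<lambda>(u, v). eval_word x y u $ fst p $ fst q * eval_word x y v $ snd p $ snd q) P"
  by (simp add: eval_tensor_def linear_extension_def scale_def kronecker_def split_def)

lemma eval_tensor_tensor:
  "eval_tensor \<phi> (f \<otimes>\<^sub>F g) x y = eval_free x y f \<otimes>\<^sub>M eval_free x y g"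
proof -
  have "eval_tensor \<phi> (f \<otimes>\<^sub>F g) x y $ p $ q = (eval_free x y f \<otimes>\<^sub>M eval_free x y g) $ p $ q" for p q
    unfolding eval_tensor_component tensor_def linear_extension_sum linear_extension_single
    by (simp add: kronecker_def eval_free_def map_mult linear_extension_def sum_product ac_simps)
  then show ?thesis by (simp add: vec_eq_iff)
qed

lemma eval_tensor_add: "eval_tensor \<phi> (P + Q) x y = eval_tensor \<phi> P x y + eval_tensor \<phi> Q x y"
  by (simp add: vec_eq_iff eval_tensor_component linear_extension_add)

lemma eval_tensor_zero: "eval_tensor \<phi> 0 x y = 0"
  by (simp add: vec_eq_iff eval_tensor_component linear_extension_zero)

end

section \<open>Balanced tensor polynomials\<close>

lemma homogeneous_add: "homogeneous d f \<Longrightarrow> homogeneous d g \<Longrightarrow> homogeneous d (f + g)"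
  using keys_add[of f g] by (auto simp: homogeneous_def)

lemma homogeneous_diff: "homogeneous d f \<Longrightarrow> homogeneous d g \<Longrightarrow> homogeneous d (f - g)"
  using keys_diff[of f g] by (auto simp: homogeneous_def)

lemma homogeneous_uminus: "homogeneous d f \<Longrightarrow> homogeneous d (- f)"
  by (simp add: homogeneous_def)

lemma homogeneous_mult:
  "homogeneous d f \<Longrightarrow> homogeneous e g \<Longrightarrow> n = d + e \<Longrightarrow> homogeneous n (f * g)"
  using keys_mult[of f g] by (fastforce simp: homogeneous_def plus_list_def)

lemma homogeneous_single: "length w = d \<Longrightarrow> homogeneous d (Poly_Mapping.single w c)"
  by (simp add: homogeneous_def)

lemma balanced_sum_list:
  assumes "\<forall>(f, g)\<in>set fgs. homogeneous d f \<and> homogeneous d g"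
  shows "balanced (\<Sum>(f, g)\<leftarrow>fgs. f \<otimes>\<^sub>F g)"
  unfolding balanced_def
proof (intro exI conjI)
  show "\<forall>i<length fgs. homogeneous d (fst (fgs ! i)) \<and> homogeneous d (snd (fgs ! i))"
    using assms by (auto simp: split_def)
  show "(\<Sum>(f, g)\<leftarrow>fgs. f \<otimes>\<^sub>F g) = (\<Sum>i<length fgs. fst (fgs ! i) \<otimes>\<^sub>F snd (fgs ! i))"
    by (simp add: sum_list_sum_nth split_def lessThan_atLeast0)
qed

section \<open>Multiplying a commutator by invariants\<close>

definition letter_matrix :: "'a mat2 \<Rightarrow> 'a mat2 \<Rightarrow> letter \<Rightarrow> 'a mat2"
  where "letter_matrix x y l = (case l of X \<Rightarrow> x | Y \<Rightarrow> y)"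

definition var :: "letter \<Rightarrow> free_algebra"
  where "var l = Poly_Mapping.single [l] 1"

text \<open>
  The commutator with a letter, lifted to the free algebra: it provides both the factors \<open>[x,C]\<close> and
  \<open>[y,C]\<close> and, applied twice, multiplication by \<open>B(z,w)\<close>.
\<close>

definition ad :: "letter \<Rightarrow> free_algebra \<Rightarrow> free_algebra"
  where "ad l f = var l * f - f * var l"

text \<open>
  This is the symmetric bilinear form whose quadratic form is \<open>tr(z)\<^sup>2 - 4 det(z)\<close>, the discriminant of
  the characteristic polynomial; it is twice the trace form on the traceless parts.
\<close>

definition polar_discriminant :: "'a::comm_ring_1 mat2 \<Rightarrow> 'a mat2 \<Rightarrow> 'a"
  where "polar_discriminant z w = 2 * trace (z ** w) - trace z * trace w"

lemma commutator_smult: "commutator z (k *\<^sub>2 M) = k *\<^sub>2 commutator z M"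
  by (simp add: commutator_def vec_eq_iff matrix_matrix_mult_def sum_distrib_left algebra_simps)

text \<open>
  Commutators and the form \<open>B\<close> see only the traceless part of a matrix. Keeping the difference of the
  diagonal entries as one unit keeps the polynomial identities below small.
\<close>

lemma commutator_component:
  "commutator z M $ 1 $ 1 = z $ 1 $ 2 * M $ 2 $ 1 - z $ 2 $ 1 * M $ 1 $ 2"
  "commutator z M $ 1 $ 2 = (z $ 1 $ 1 - z $ 2 $ 2) * M $ 1 $ 2 - z $ 1 $ 2 * (M $ 1 $ 1 - M $ 2 $ 2)"
  "commutator z M $ 2 $ 1 = z $ 2 $ 1 * (M $ 1 $ 1 - M $ 2 $ 2) - (z $ 1 $ 1 - z $ 2 $ 2) * M $ 2 $ 1"
  "commutator z M $ 2 $ 2 = z $ 2 $ 1 * M $ 1 $ 2 - z $ 1 $ 2 * M $ 2 $ 1"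
  by (simp_all add: commutator_def matrix_matrix_mult_def sum_2 algebra_simps)

lemma polar_discriminant_component:
  "polar_discriminant z w = (z $ 1 $ 1 - z $ 2 $ 2) * (w $ 1 $ 1 - w $ 2 $ 2)
     + 2 * (z $ 1 $ 2 * w $ 2 $ 1 + z $ 2 $ 1 * w $ 1 $ 2)"
  by (simp add: polar_discriminant_def trace_def sum_2 matrix_matrix_mult_def algebra_simps)

text \<open>
  As \<open>C z = adj(z) C\<close>, the double commutator \<open>z w C - z C w - w C z + C w z\<close> is
  \<open>(z w + adj(z w) - z adj(w) - w adj(z)) C\<close>, and the bracket is the scalar
  \<open>tr(z w) - tr(z adj(w)) = B(z,w)\<close>.
\<close>

lemma double_commutator:
  assumes "z \<in> {x, y}" "w \<in> {x, y}"
  shows "commutator z (commutator w (commutator x y)) = polar_discriminant z w *\<^sub>2 commutator x y"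
proof -
  define p q where "p = x $ 1 $ 1 - x $ 2 $ 2" and "q = y $ 1 $ 1 - y $ 2 $ 2"
  show ?thesis
    using assms unfolding vec_eq_iff forall_2
    by (elim insertE emptyE; simp only: commutator_component polar_discriminant_component
        nth_map_matrix flip: p_def q_def; simp add: algebra_simps)
qed

text \<open>
  The next three identities express \<open>z + adj(z) = tr(z)\<close>, \<open>z adj(z) = det(z)\<close> and
  \<open>x y + adj(x y) = tr(x y)\<close>, with the adjugate produced by moving \<open>C\<close> past \<open>z\<close>.
\<close>

lemma trace_commutator:
  assumes "z \<in> {x, y}"
  shows "z ** (c *\<^sub>2 commutator x y) + (c *\<^sub>2 commutator x y) ** z = (trace z * c) *\<^sub>2 commutator x y"
  using assms
  by (elim insertE emptyE; simp add: vec_eq_iff forall_2 commutator_def trace_def sum_2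
      matrix_matrix_mult_def algebra_simps)

lemma det_commutator:
  assumes "z \<in> {x, y}"
  shows "z ** (c *\<^sub>2 commutator x y) ** z = (det z * c) *\<^sub>2 commutator x y"
  using assms
  by (elim insertE emptyE; simp add: vec_eq_iff forall_2 commutator_def det_2 sum_2
      matrix_matrix_mult_def algebra_simps)

lemma trace_mult_commutator:
  "x ** y ** (c *\<^sub>2 commutator x y) + (c *\<^sub>2 commutator x y) ** y ** x =
     (trace (x ** y) * c) *\<^sub>2 commutator x y"
  by (simp add: vec_eq_iff forall_2 commutator_def trace_def sum_2
      matrix_matrix_mult_def algebra_simps)

text \<open>
  Invariants are kept as lists of formal factors, so that the polynomials below depend on the factors
  alone and can be evaluated at any pair of matrices.
\<close>

datatype invariant = Trace letter | Det letter | Trace_XY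

fun invariant_value :: "'a::comm_ring_1 mat2 \<Rightarrow> 'a mat2 \<Rightarrow> invariant \<Rightarrow> 'a" where
  "invariant_value x y (Trace l) = trace (letter_matrix x y l)"
| "invariant_value x y (Det l) = det (letter_matrix x y l)"
| "invariant_value x y Trace_XY = trace (x ** y)"

fun invariant_degree :: "invariant \<Rightarrow> nat" where
  "invariant_degree (Trace l) = 1"
| "invariant_degree (Det l) = 2"
| "invariant_degree Trace_XY = 2"

definition weight :: "invariant list \<Rightarrow> nat"
  where "weight Is = sum_list (map invariant_degree Is)"

fun multiply :: "invariant \<Rightarrow> free_algebra \<Rightarrow> free_algebra" where
  "multiply (Trace l) f = var l * f + f * var l"
| "multiply (Det l) f = var l * f * var l"
| "multiply Trace_XY f = var X * var Y * f + f * var Y * var X"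

definition invariant_commutator :: "invariant list \<Rightarrow> free_algebra"
  where "invariant_commutator Is = foldr multiply Is (ad X (var Y))"

lemma homogeneous_var: "homogeneous 1 (var l)"
  by (simp add: var_def homogeneous_single)

lemma homogeneous_ad: "homogeneous d f \<Longrightarrow> n = Suc d \<Longrightarrow> homogeneous n (ad l f)"
  unfolding ad_def
  by (intro homogeneous_diff homogeneous_mult[OF homogeneous_var, of d]
      homogeneous_mult[OF _ homogeneous_var, of d]) auto

lemma homogeneous_multiply:
  "homogeneous d f \<Longrightarrow> homogeneous (invariant_degree i + d) (multiply i f)"
  by (cases i) (auto intro!: homogeneous_add homogeneous_mult homogeneous_var)

lemma homogeneous_invariant_commutator:
  "n = weight Is + 2 \<Longrightarrow> homogeneous n (invariant_commutator Is)"
proof (induction Is arbitrary: n)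
  case Nil
  then show ?case
    by (auto simp: invariant_commutator_def weight_def numeral_2_eq_2
        intro!: homogeneous_ad homogeneous_var[simplified])
next
  case (Cons i Is)
  then show ?case
    using homogeneous_multiply[of "weight Is + 2" "invariant_commutator Is" i]
    by (simp add: invariant_commutator_def weight_def add.assoc)
qed

context rational_algebra
begin

lemma eval_var: "eval_free x y (var l) = letter_matrix x y l"
  by (cases l) (simp_all add: var_def eval_free_single map_one letter_matrix_def vec_eq_iff)

lemma eval_ad: "eval_free x y (ad l f) = commutator (letter_matrix x y l) (eval_free x y f)"
  by (simp add: ad_def eval_free_diff eval_free_mult eval_var commutator_def)

lemma eval_multiply:
  assumes "eval_free x y f = c *\<^sub>2 commutator x y"
  shows "eval_free x y (multiply i f) = (invariant_value x y i * c) *\<^sub>2 commutator x y"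
proof (cases i)
  case (Trace l)
  with assms show ?thesis
    by (cases l) (simp_all add: eval_free_add eval_free_mult eval_var letter_matrix_def trace_commutator)
next
  case (Det l)
  with assms show ?thesis
    by (cases l) (simp_all add: eval_free_mult eval_var letter_matrix_def det_commutator)
next
  case Trace_XY
  with assms show ?thesis
    by (simp add: eval_free_add eval_free_mult eval_var letter_matrix_def trace_mult_commutator)
qed

lemma eval_invariant_commutator:
  "eval_free x y (invariant_commutator Is) =
     prod_list (map (invariant_value x y) Is) *\<^sub>2 commutator x y"
proof (induction Is)
  case Nil
  then show ?case
    by (simp add: invariant_commutator_def eval_ad eval_var letter_matrix_def vec_eq_iff)
next
  case (Cons i Is)
  then show ?case
    by (simp add: invariant_commutator_def eval_multiply)
qed

end

section \<open>The swap operator in the frame of a commutator\<close>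

text \<open>Doubling the traceless part \<open>z - tr(z)/2\<close> avoids dividing by \<open>2\<close>.\<close>

definition double_traceless :: "'a::comm_ring_1 mat2 \<Rightarrow> 'a mat2"
  where "double_traceless z = z + z - mat (trace z)"

lemma kronecker_mult: "(K \<otimes>\<^sub>M L) ** (M \<otimes>\<^sub>M N) = (K ** M) \<otimes>\<^sub>M (L ** N)"
  by (simp add: vec_eq_iff kronecker_def matrix_matrix_mult_def sum_product
      sum.cartesian_product UNIV_Times_UNIV[symmetric] split_def ac_simps del: UNIV_Times_UNIV)

lemma swap_operator_component:
  "swap_operator $ p $ q = (if p = (snd q, fst q) then 1 else 0)"
proof -
  have "swap_operator $ p $ q = (\<Sum>i\<in>UNIV. \<Sum>j\<in>UNIV.
      if j = fst q then if i = snd q \<and> p = (snd q, fst q) then 1 else 0 else (0::'a))"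
    unfolding swap_operator_def kronecker_def matrix_unit_def
    by (simp only: sum_component vec_lambda_beta, intro sum.cong refl) (auto simp: prod_eq_iff)
  also have "\<dots> = (\<Sum>i\<in>UNIV. if i = snd q then if p = (snd q, fst q) then 1 else 0 else (0::'a))"
    by (intro sum.cong refl) simp
  finally show ?thesis
    by simp
qed

text \<open>
  This is the entrywise form of \<open>scale_swap_times_commutators\<close>. Let \<open>u, v\<close> be the doubled traceless
  parts of \<open>x, y\<close>. The trace form vanishes between \<open>1\<close>, \<open>C\<close> and the span of \<open>u, v\<close>; it has
  \<open>tr(1) = 2\<close>, \<open>tr(C\<^sup>2) = 2D\<close>, and Gram matrix \<open>2B\<close> on \<open>u, v\<close>, where
  \<open>B(x,y)\<^sup>2 - B(x,x) B(y,y) = 4D\<close>. Inverting it, \<open>t = \<Sum>\<^sub>i b\<^sub>i \<otimes> b\<^sub>i\<^sup>*\<close> becomes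
  \<open>8D t = 4D 1 \<otimes> 1 + 4 C \<otimes> C - B(y,y) u \<otimes> u + B(x,y) (u \<otimes> v + v \<otimes> u) - B(x,x) v \<otimes> v\<close>.
  Multiplication by \<open>C \<otimes> C\<close> exchanges the first two terms up to the factor \<open>D\<close>, and on the
  plane spanned by \<open>u\<close> and \<open>v\<close> it acts as \<open>-D\<close> on the form that is left; dividing by \<open>D\<close> gives
  the identity when \<open>D\<close> is invertible, and then, being polynomial, over every commutative ring.
\<close>

lemma casimir:
  fixes x y :: "'a::comm_ring_1 mat2"
  defines "C \<equiv> commutator x y" and "u \<equiv> double_traceless x" and "v \<equiv> double_traceless y"
  shows "8 * (C $ i $ l * C $ j $ k) = 4 * (C $ i $ k * C $ j $ l)
    + (polar_discriminant x y * polar_discriminant x y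
       - polar_discriminant x x * polar_discriminant y y) * (mat 1 $ i $ k * mat 1 $ j $ l)
    + polar_discriminant y y * (u $ i $ k * u $ j $ l)
    - polar_discriminant x y * (u $ i $ k * v $ j $ l + v $ i $ k * u $ j $ l)
    + polar_discriminant x x * (v $ i $ k * v $ j $ l)"
proof -
  define p q where "p = x $ 1 $ 1 - x $ 2 $ 2" and "q = y $ 1 $ 1 - y $ 2 $ 2"
  have u: "u $ 1 $ 1 = p" "u $ 1 $ 2 = 2 * x $ 1 $ 2" "u $ 2 $ 1 = 2 * x $ 2 $ 1" "u $ 2 $ 2 = - p"
    and v: "v $ 1 $ 1 = q" "v $ 1 $ 2 = 2 * y $ 1 $ 2" "v $ 2 $ 1 = 2 * y $ 2 $ 1" "v $ 2 $ 2 = - q"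
    unfolding u_def v_def p_def q_def by (simp_all add: double_traceless_def trace_def sum_2 mat_def)
  have I: "(mat 1 :: 'a mat2) $ 1 $ 1 = 1" "(mat 1 :: 'a mat2) $ 1 $ 2 = 0"
    "(mat 1 :: 'a mat2) $ 2 $ 1 = 0" "(mat 1 :: 'a mat2) $ 2 $ 2 = 1"
    by (simp_all add: mat_def)
  have "i = 1 \<or> i = 2" "j = 1 \<or> j = 2" "k = 1 \<or> k = 2" "l = 1 \<or> l = 2"
    using exhaust_2 by blast+
  then show ?thesis
    by (elim disjE; simp only: C_def commutator_component polar_discriminant_component u v I
        flip: p_def q_def; simp add: algebra_simps)
qed

lemma swap_operator_mult_kronecker:
  "(M \<otimes>\<^sub>M N) ** swap_operator = (\<chi> p q. M $ fst p $ snd q * N $ snd p $ fst q)"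
  by (simp add: vec_eq_iff kronecker_def matrix_matrix_mult_def swap_operator_component
    if_distrib[of "\<lambda>a. _ * a"] cong: if_cong)

lemma scale_swap_times_commutators:
  fixes x y :: "'a::comm_ring_1 mat2"
  defines "C \<equiv> commutator x y" and "u \<equiv> double_traceless x" and "v \<equiv> double_traceless y"
  shows "8 *\<^sub>M ((C \<otimes>\<^sub>M C) ** swap_operator) =
      4 *\<^sub>M (C \<otimes>\<^sub>M C)
    + (polar_discriminant x y * polar_discriminant x y
       - polar_discriminant x x * polar_discriminant y y) *\<^sub>M (mat 1 \<otimes>\<^sub>M mat 1)
    + polar_discriminant y y *\<^sub>M (u \<otimes>\<^sub>M u)
    - polar_discriminant x y *\<^sub>M (u \<otimes>\<^sub>M v + v \<otimes>\<^sub>M u)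
    + polar_discriminant x x *\<^sub>M (v \<otimes>\<^sub>M v)" (is "_ = ?rhs")
proof -
  have "(8 *\<^sub>M ((C \<otimes>\<^sub>M C) ** swap_operator)) $ (i, j) $ (k, l) = ?rhs $ (i, j) $ (k, l)" for i j k l
    unfolding swap_operator_mult_kronecker
    using casimir[of x y i l j k, folded C_def u_def v_def]
    by (simp add: scale_def kronecker_def)
  then show ?thesis
    by (simp add: vec_eq_iff split_paired_all)
qed

lemma commutator_mult_double_traceless:
  assumes "z \<in> {x, y}"
  shows "commutator x y ** double_traceless z = - commutator z (commutator x y)"
  using assms
  by (elim insertE emptyE; simp add: vec_eq_iff forall_2 commutator_def double_traceless_def
      trace_def mat_def sum_2 matrix_matrix_mult_def algebra_simps)

lemma mult_scale: "T ** (c *\<^sub>M U) = c *\<^sub>M (T ** U)"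
  by (simp add: vec_eq_iff scale_def matrix_matrix_mult_def sum_distrib_left ac_simps)

lemma mult_diff: "T ** (U - V) = T ** U - T ** (V :: 'a::comm_ring_1 mat2_tensor)"
  by (simp add: vec_eq_iff matrix_matrix_mult_def right_diff_distrib sum_subtractf)

lemma kronecker_uminus: "(- M) \<otimes>\<^sub>M (- N) = M \<otimes>\<^sub>M N"
  by (simp add: vec_eq_iff kronecker_def)

text \<open>
  A further factor \<open>C \<otimes> C\<close> turns the left-hand side of \<open>scale_swap_times_commutators\<close> into a multiple
  of \<open>t\<close>, because \<open>C\<^sup>2 \<otimes> C\<^sup>2 = D\<^sup>2\<close>, and puts a commutator into every factor on the right.
\<close>

lemma swap_operator_expansion:
  fixes x y :: "'a::comm_ring_1 mat2"
  defines "C \<equiv> commutator x y"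
  defines "u \<equiv> commutator x C" and "v \<equiv> commutator y C"
  shows "(8 * (commutator_square x y)\<^sup>2) *\<^sub>M swap_operator =
      4 *\<^sub>M ((C ** C) \<otimes>\<^sub>M (C ** C))
    + (polar_discriminant x y * polar_discriminant x y
       - polar_discriminant x x * polar_discriminant y y) *\<^sub>M (C \<otimes>\<^sub>M C)
    + polar_discriminant y y *\<^sub>M (u \<otimes>\<^sub>M u)
    - polar_discriminant x y *\<^sub>M (u \<otimes>\<^sub>M v + v \<otimes>\<^sub>M u)
    + polar_discriminant x x *\<^sub>M (v \<otimes>\<^sub>M v)"
proof -
  let ?D = "commutator_square x y"
  have "mat ?D \<otimes>\<^sub>M mat ?D = (?D\<^sup>2) *\<^sub>M mat 1"
    by (auto simp: vec_eq_iff kronecker_def scale_def mat_def power2_eq_square prod_eq_iff)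
  moreover have "(c *\<^sub>M mat 1) ** T = c *\<^sub>M T" for c and T :: "'a mat2_tensor"
    by (simp add: vec_eq_iff scale_def mat_def matrix_matrix_mult_def
        if_distrib[of "\<lambda>a. a * _"] if_distrib[of "\<lambda>a. _ * a"] cong: if_cong)
  ultimately have "(C \<otimes>\<^sub>M C) ** (8 *\<^sub>M ((C \<otimes>\<^sub>M C) ** swap_operator)) =
      8 *\<^sub>M ?D\<^sup>2 *\<^sub>M swap_operator"
    by (simp add: mult_scale matrix_mul_assoc kronecker_mult C_def commutator_square)
  also have "\<dots> = (8 * ?D\<^sup>2) *\<^sub>M swap_operator"
    by (simp add: vec_eq_iff scale_def mult.assoc)
  finally show ?thesis
    unfolding C_def u_def v_def scale_swap_times_commutators
    by (simp add: mult_scale mult_diff matrix_add_ldistrib kronecker_mult kronecker_uminus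
        commutator_mult_double_traceless)
qed

section \<open>The balanced swap polynomial\<close>

text \<open>
  These are the summands of \<open>swap_operator_expansion\<close> with one \<open>C\<close> on each side replaced by a polynomial
  of value \<open>I C\<close> or \<open>J C\<close> (\<open>f\<close>, \<open>g\<close>) in the first three, and of value \<open>I' C\<close> or \<open>J' C\<close>
  (\<open>f'\<close>, \<open>g'\<close>) in the others. A pair of \<open>ad\<close> is a factor \<open>B\<close>; a single one, or the outermost of three,
  is the commutator \<open>[x,C]\<close> or \<open>[y,C]\<close>. Since \<open>f'\<close> carries the extra factor \<open>B\<close>, its degree
  has to be smaller by \<open>2\<close> than that of \<open>g'\<close>.
\<close>

definition swap_summands ::
    "free_algebra \<Rightarrow> free_algebra \<Rightarrow> free_algebra \<Rightarrow> free_algebra \<Rightarrow> (free_algebra \<times> free_algebra) list"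
  where "swap_summands f g f' g' =
    [((f + f) * ad X (var Y), (g + g) * ad X (var Y)),
     (ad X (ad Y f), ad X (ad Y g)),
     (- ad X (ad X f), ad Y (ad Y g)),
     (ad X (ad Y (ad Y f')), ad X g'),
     (- ad X (ad X (ad Y f')), ad Y g'),
     (- ad Y (ad X (ad Y f')), ad X g'),
     (ad Y (ad X (ad X f')), ad Y g')]"

definition swap_combination ::
    "free_algebra \<Rightarrow> free_algebra \<Rightarrow> free_algebra \<Rightarrow> free_algebra \<Rightarrow> tensor_polynomial"
  where "swap_combination f g f' g' = (\<Sum>(p, q)\<leftarrow>swap_summands f g f' g'. p \<otimes>\<^sub>F q)"

lemma balanced_swap_combination:
  assumes "homogeneous (Suc d) f" "homogeneous (Suc d) g"
    and "homogeneous d f'" "homogeneous (d + 2) g'"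
  shows "balanced (swap_combination f g f' g')"
  unfolding swap_combination_def
proof (rule balanced_sum_list)
  have "homogeneous 2 (ad X (var Y))"
    by (rule homogeneous_ad[OF homogeneous_var]) simp
  then show "\<forall>(p, q)\<in>set (swap_summands f g f' g'). homogeneous (d + 3) p \<and> homogeneous (d + 3) q"
    by (auto simp: swap_summands_def intro!: homogeneous_uminus homogeneous_ad assms
        homogeneous_mult[of "Suc d" _ 2] homogeneous_add)
qed

lemma (in rational_algebra) eval_swap_combination:
  assumes f: "eval_free x y f = a *\<^sub>2 commutator x y" and g: "eval_free x y g = b *\<^sub>2 commutator x y"
    and f': "eval_free x y f' = a' *\<^sub>2 commutator x y" and g': "eval_free x y g' = b' *\<^sub>2 commutator x y"
    and same_product: "a' * b' = a * b"
  shows "eval_tensor \<phi> (swap_combination f g f' g') x y =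
    (8 * (a * b) * (commutator_square x y)\<^sup>2) *\<^sub>M swap_operator"
proof -
  let ?C = "commutator x y" and ?B = polar_discriminant
  have ad_ad: "eval_free x y (ad l (ad m h)) =
      (?B (letter_matrix x y l) (letter_matrix x y m) * c) *\<^sub>2 ?C"
    if "eval_free x y h = c *\<^sub>2 ?C" for l m h c
  proof -
    have "letter_matrix x y l \<in> {x, y}" for l
      by (cases l) (simp_all add: letter_matrix_def)
    note double = double_commutator[OF this[of l] this[of m]]
    show ?thesis
      by (simp add: eval_ad that commutator_smult double) (simp add: vec_eq_iff ac_simps)
  qed
  have bilinear: "(c *\<^sub>2 M) \<otimes>\<^sub>M (d *\<^sub>2 N) = (c * d) *\<^sub>M (M \<otimes>\<^sub>M N)" for c d and M N :: "'a mat2"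
    by (simp add: vec_eq_iff kronecker_def scale_def ac_simps)
  have minus: "(- (c *\<^sub>2 M)) = (- c) *\<^sub>2 M" for c and M :: "'a mat2"
    by (simp add: vec_eq_iff)
  have double: "c *\<^sub>2 M + c *\<^sub>2 M = (2 * c) *\<^sub>2 M" for c and M :: "'a mat2"
    by (simp add: vec_eq_iff algebra_simps)
  have smult_mult: "(c *\<^sub>2 M) ** N = c *\<^sub>2 (M ** N)" for c and M N :: "'a mat2"
    by (simp add: vec_eq_iff matrix_matrix_mult_def sum_distrib_left algebra_simps)
  have [simp]: "letter_matrix x y X = x" "letter_matrix x y Y = y"
    by (simp_all add: letter_matrix_def)
  have B_sym: "?B y x = ?B x y"
    by (simp add: polar_discriminant_def trace_mul_sym[of x y] mult.commute)
  have "eval_tensor \<phi> (swap_combination f g f' g') x y =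
      (4 * (a * b)) *\<^sub>M ((?C ** ?C) \<otimes>\<^sub>M (?C ** ?C))
    + (?B x y * ?B x y * (a * b)) *\<^sub>M (?C \<otimes>\<^sub>M ?C)
    + (- (?B x x * ?B y y * (a * b))) *\<^sub>M (?C \<otimes>\<^sub>M ?C)
    + (?B y y * (a' * b')) *\<^sub>M (commutator x ?C \<otimes>\<^sub>M commutator x ?C)
    + (- (?B x y * (a' * b'))) *\<^sub>M (commutator x ?C \<otimes>\<^sub>M commutator y ?C)
    + (- (?B x y * (a' * b'))) *\<^sub>M (commutator y ?C \<otimes>\<^sub>M commutator x ?C)
    + (?B x x * (a' * b')) *\<^sub>M (commutator y ?C \<otimes>\<^sub>M commutator y ?C)"
    unfolding swap_combination_def swap_summands_def
    by (simp add: eval_tensor_add eval_tensor_zero eval_tensor_tensor eval_free_uminus ad_ad[OF f]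
        ad_ad[OF g] eval_ad[of x y _ "ad _ (ad _ _)"] ad_ad[OF f'] eval_ad[of x y _ g'] g'
        commutator_smult bilinear minus eval_free_mult eval_free_add f g double smult_mult
        eval_ad[of x y _ "var _"] eval_var)
       (simp add: ac_simps)
  also have "\<dots> = (a * b) *\<^sub>M (8 * (commutator_square x y)\<^sup>2) *\<^sub>M swap_operator"
    unfolding swap_operator_expansion same_product
    by (simp add: vec_eq_iff scale_def algebra_simps)
  also have "\<dots> = (8 * (a * b) * (commutator_square x y)\<^sup>2) *\<^sub>M swap_operator"
    by (simp add: vec_eq_iff scale_def ac_simps)
  finally show ?thesis .
qed

text \<open>
  The factor \<open>1/8\<close> cancels the \<open>8\<close> of \<open>swap_operator_expansion\<close>; each summand has one
  factor from \<open>Is\<close> or \<open>Is'\<close> and one from \<open>Js\<close> or \<open>Js'\<close>, so scaling the former suffices.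
\<close>

definition swap_witness ::
    "invariant list \<Rightarrow> invariant list \<Rightarrow> invariant list \<Rightarrow> invariant list \<Rightarrow> tensor_polynomial"
  where "swap_witness Is Js Is' Js' =
    (let eighth = Poly_Mapping.single 0 (1 / 8) in
     swap_combination (eighth * invariant_commutator Is) (invariant_commutator Js)
       (eighth * invariant_commutator Is') (invariant_commutator Js'))"

lemma balanced_swap_witness:
  assumes "weight Is = Suc n" "weight Js = Suc n" "weight Is' = n" "weight Js' = n + 2"
  shows "balanced (swap_witness Is Js Is' Js')"
  unfolding swap_witness_def Let_def
proof (rule balanced_swap_combination)
  have eighth: "homogeneous 0 (Poly_Mapping.single 0 (1 / 8))"
    by (simp add: homogeneous_def zero_list_def)
  show "homogeneous (Suc (n + 2)) (Poly_Mapping.single 0 (1 / 8) * invariant_commutator Is)"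
    "homogeneous (n + 2) (Poly_Mapping.single 0 (1 / 8) * invariant_commutator Is')"
    using assms by (auto intro!: homogeneous_mult[OF eighth] homogeneous_invariant_commutator)
  show "homogeneous (Suc (n + 2)) (invariant_commutator Js)"
    "homogeneous (n + 2 + 2) (invariant_commutator Js')"
    using assms by (auto intro!: homogeneous_invariant_commutator)
qed

lemma (in rational_algebra) eval_swap_witness:
  assumes "mset (Is @ Js) = mset Ks" "mset (Is' @ Js') = mset Ks"
  shows "eval_tensor \<phi> (swap_witness Is Js Is' Js') x y =
    (prod_list (map (invariant_value x y) Ks) * (commutator_square x y)\<^sup>2) *\<^sub>M swap_operator"
proof -
  let ?v = "\<lambda>Is. prod_list (map (invariant_value x y) Is)"
  have product: "?v Is * ?v Js = ?v Ks" if "mset (Is @ Js) = mset Ks" for Is Js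
    using arg_cong[OF that, of "\<lambda>M. prod_mset (image_mset (invariant_value x y) M)"]
    by (simp flip: prod_mset_prod_list)
  have "\<phi> (of_nat n * r) = of_nat n * \<phi> r" for n r
    by (induction n) (simp_all add: map_zero map_add algebra_simps)
  from this[of 8 "1 / 8"] have eighth: "8 * \<phi> (1 / 8) = 1"
    by (simp add: map_one)
  have scaled: "eval_free x y (Poly_Mapping.single 0 (1 / 8) * invariant_commutator Is) =
      (\<phi> (1 / 8) * ?v Is) *\<^sub>2 commutator x y" for Is
  proof -
    have "(c *\<^sub>2 mat 1) ** M = c *\<^sub>2 M" for c and M :: "'a mat2"
      by (simp add: vec_eq_iff mat_def matrix_matrix_mult_def
          if_distrib[of "\<lambda>a. a * _"] if_distrib[of "\<lambda>a. _ * a"] cong: if_cong)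
    then show ?thesis
      by (simp add: eval_free_mult eval_free_single zero_list_def eval_invariant_commutator
          vec_eq_iff mult.assoc)
  qed
  have "eval_tensor \<phi> (swap_witness Is Js Is' Js') x y =
      (8 * ((\<phi> (1 / 8) * ?v Is) * ?v Js) * (commutator_square x y)\<^sup>2) *\<^sub>M swap_operator"
    unfolding swap_witness_def Let_def
    by (rule eval_swap_combination[OF scaled eval_invariant_commutator scaled eval_invariant_commutator])
      (simp add: mult.assoc product[OF assms(1)] product[OF assms(2)])
  also have "8 * ((\<phi> (1 / 8) * ?v Is) * ?v Js) = (8 * \<phi> (1 / 8)) * (?v Is * ?v Js)"
    by (simp add: mult.assoc)
  finally show ?thesis
    by (simp add: eighth product[OF assms(1)])
qed

text \<open>
  If the number of quadratic factors is even, halve the quadratic factors and choose \<open>h\<close> or \<open>h - 1\<close>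
  of the \<open>2h\<close> linear ones for the first list. If it is odd, the quadratic factors differ
  by one: an extra one in the first list is compensated by two more linear factors in the second, and an
  extra one in the second list gives the required difference of \<open>2\<close>.
\<close>

lemma balanced_splittings:
  assumes ts: "length ts = 2 * h" "h > 0" "\<forall>i\<in>set ts. invariant_degree i = 1"
    and qs: "\<forall>i\<in>set qs. invariant_degree i = 2"
  obtains Is Js Is' Js' n where "mset (Is @ Js) = mset (ts @ qs)" "mset (Is' @ Js') = mset (ts @ qs)"
    "weight Is = Suc n" "weight Js = Suc n" "weight Is' = n" "weight Js' = n + 2"
proof -
  let ?I = "\<lambda>a b. take a ts @ take b qs" and ?J = "\<lambda>a b. drop a ts @ drop b qs"
  have split: "mset (?I a b @ ?J a b) = mset (ts @ qs)" for a b
  proof -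
    have "mset xs = mset (take m xs) + mset (drop m xs)" for m and xs :: "invariant list"
      by (metis append_take_drop_id mset_append)
    note pieces = this[of ts a] this[of qs b]
    show ?thesis
      by (simp only: mset_append pieces ac_simps)
  qed
  have weight_const: "weight xs = c * length xs" if "\<forall>i\<in>set xs. invariant_degree i = c" for xs c
    using that unfolding weight_def by (induction xs) auto
  have weight_append: "weight (xs @ ys) = weight xs + weight ys" for xs ys
    by (simp add: weight_def)
  have "weight (take a ts) = min (2 * h) a" "weight (drop a ts) = 2 * h - a" for a
    using ts weight_const[of "take a ts" 1] weight_const[of "drop a ts" 1]
    by (auto dest: in_set_takeD in_set_dropD)
  moreover have "weight (take b qs) = 2 * min (length qs) b" "weight (drop b qs) = 2 * (length qs - b)" for b
    using qs weight_const[of "take b qs" 2] weight_const[of "drop b qs" 2]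
    by (auto dest: in_set_takeD in_set_dropD)
  ultimately have I: "weight (?I a b) = min (2 * h) a + 2 * min (length qs) b"
    and J: "weight (?J a b) = (2 * h - a) + 2 * (length qs - b)" for a b
    by (simp_all add: weight_append)
  show thesis
  proof (cases "even (length qs)")
    case True
    then obtain l where "length qs = 2 * l" by blast
    with \<open>h > 0\<close> show thesis
      by (intro that[of "?I h l" "?J h l" "?I (h - 1) l" "?J (h - 1) l" "h + 2 * l - 1"] split)
        (simp_all add: I J)
  next
    case False
    then obtain l where "length qs = 2 * l + 1" by (auto elim: oddE)
    with \<open>h > 0\<close> show thesis
      by (intro that[of "?I (h - 1) (Suc l)" "?J (h - 1) (Suc l)" "?I h l" "?J h l" "h + 2 * l"] split)
        (simp_all add: I J)
  qed
qed

text \<open>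
  A value at which no factor vanishes shows that the swap polynomial does not vanish identically.
\<close>

lemma exists_nonvanishing_matrices:
  obtains x y :: "rat mat2" where "\<forall>i. invariant_value x y i \<noteq> 0" "commutator_square x y \<noteq> 0"
proof
  define x y :: "rat mat2"
    where "x = (\<chi> i j. if i = j then if i = 1 then 1 else 2 else 0)"
      and "y = (\<chi> i j. if i = 2 \<and> j = 2 then 3 else 1)"
  have entries: "x $ 1 $ 1 = 1" "x $ 1 $ 2 = 0" "x $ 2 $ 1 = 0" "x $ 2 $ 2 = 2"
    "y $ 1 $ 1 = 1" "y $ 1 $ 2 = 1" "y $ 2 $ 1 = 1" "y $ 2 $ 2 = 3"
    by (simp_all add: x_def y_def)
  show "commutator_square x y \<noteq> 0"
    by (simp add: commutator_square_def commutator_def det_2 matrix_matrix_mult_def sum_2 entries)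
  show "\<forall>i. invariant_value x y i \<noteq> 0"
  proof
    fix i
    show "invariant_value x y i \<noteq> 0"
    proof (cases i)
      case (Trace l)
      then show ?thesis by (cases l) (simp_all add: letter_matrix_def trace_def sum_2 entries)
    next
      case (Det l)
      then show ?thesis by (cases l) (simp_all add: letter_matrix_def det_2 entries)
    next
      case Trace_XY
      then show ?thesis by (simp add: trace_def sum_2 matrix_matrix_mult_def entries)
    qed
  qed
qed

theorem theorem3p11:
  fixes x y :: "entry_polynomial mat2"
    and A A\<^sub>1 A\<^sub>2 :: entry_polynomial
    and ps qs :: "entry_polynomial list"
    and h k :: nat
  assumes x: "x = generic X" and y: "y = generic Y"
    and A: "A = A\<^sub>1 * A\<^sub>2"
    and A1: "A\<^sub>1 = prod_list ps" "set ps \<subseteq> {trace x, trace y}" "length ps = 2 * h" "2 * h > 0"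
    and A2: "A\<^sub>2 = prod_list qs" "set qs \<subseteq> {det x, det y, trace (x ** y)}" "length qs = k"
    and parity: "(\<exists>l. k = 2 * l) \<or> ((\<exists>l. k = 2 * l + 1) \<and> h \<ge> 2)"
  shows "\<exists>P. swap_polynomial P \<and> balanced P \<and>
    eval_tensor const P x y = (A * (commutator_square x y)\<^sup>2) *\<^sub>M swap_operator"
proof -
  let ?v = "invariant_value x y"
  have "\<forall>p\<in>set ps. \<exists>l. p = ?v (Trace l)"
    using A1(2) by (auto simp: letter_matrix_def split: letter.split intro: exI[of _ X] exI[of _ Y])
  then have "\<forall>p\<in>set ps. \<exists>l. p = (?v \<circ> Trace) l" by simp
  then obtain ls where ls: "ps = map (?v \<circ> Trace) ls"
    unfolding ex_map_conv[symmetric] by blast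
  have "\<exists>i. q = ?v i \<and> invariant_degree i = 2" if "q \<in> set qs" for q
  proof -
    from that A2(2) consider "q = det x" | "q = det y" | "q = trace (x ** y)" by blast
    then show ?thesis
    proof cases
      case 1 then show ?thesis by (intro exI[of _ "Det X"]) (simp add: letter_matrix_def)
    next
      case 2 then show ?thesis by (intro exI[of _ "Det Y"]) (simp add: letter_matrix_def)
    next
      case 3 then show ?thesis by (intro exI[of _ Trace_XY]) simp
    qed
  qed
  then obtain i where i: "\<And>q. q \<in> set qs \<Longrightarrow> q = ?v (i q) \<and> invariant_degree (i q) = 2"
    by metis
  define ts ds where "ts = map Trace ls" and "ds = map i qs"
  have "map (?v \<circ> i) qs = qs"
    using i by (simp add: map_idI)
  then have A_value: "A = prod_list (map ?v (ts @ ds))"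
    by (simp add: A A1(1) A2(1) ts_def ds_def) (simp add: ls)
  have "length ts = 2 * h" "h > 0" "\<forall>i\<in>set ts. invariant_degree i = 1"
    "\<forall>i\<in>set ds. invariant_degree i = 2"
    using A1(3,4) i by (auto simp: ts_def ds_def ls)
  then obtain Is Js Is' Js' n where split: "mset (Is @ Js) = mset (ts @ ds)"
      "mset (Is' @ Js') = mset (ts @ ds)"
    and weights: "weight Is = Suc n" "weight Js = Suc n" "weight Is' = n" "weight Js' = n + 2"
    by (rule balanced_splittings)
  let ?P = "swap_witness Is Js Is' Js'"
  note eval_rat = rational_algebra.eval_swap_witness[OF rational_algebra_id split]
  obtain x\<^sub>0 y\<^sub>0 :: "rat mat2" where nonzero:
      "\<forall>i. invariant_value x\<^sub>0 y\<^sub>0 i \<noteq> 0" "commutator_square x\<^sub>0 y\<^sub>0 \<noteq> 0"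
    by (rule exists_nonvanishing_matrices)
  \<comment> \<open>The swap operator fixes \<open>e\<^sub>1 \<otimes> e\<^sub>1\<close>, so this entry is the scalar itself.\<close>
  have "eval_tensor id ?P x\<^sub>0 y\<^sub>0 $ (1, 1) $ (1, 1) \<noteq> 0"
    using nonzero
    by (simp add: eval_rat scale_def swap_operator_component prod_list_zero_iff image_iff)
  then have "eval_tensor id ?P x\<^sub>0 y\<^sub>0 \<noteq> 0"
    by auto
  then have "swap_polynomial ?P"
    unfolding swap_polynomial_def using eval_rat by blast
  moreover have "balanced ?P"
    using weights by (rule balanced_swap_witness)
  moreover have "eval_tensor const ?P x y = (A * (commutator_square x y)\<^sup>2) *\<^sub>M swap_operator"
    unfolding A_value by (rule rational_algebra.eval_swap_witness[OF rational_algebra_const split])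
  ultimately show ?thesis by blast
qed

end
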